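(* As $n\to\infty$, the threshold bias of the (original, non-budget) $(1:q)$ $K_4$-Game on $K_n$ satisfies $$q_{K_4}(n)\le\left(5^{6/5}\,2^{-9/5}e^{2/5}+o(1)\right)n^{2/5}.$$
   Context: The $(1:q)$ $K_4$-Game on the complete graph $K_n$ is played by Maker and Breaker. In each round, Maker first claims one previously unclaimed edge of $K_n$, whereafter Breaker claims $q$ previously unclaimed edges of $K_n$ (unless fewer than $q$ unclaimed edges remain, in which case he claims all remaining edges). Maker wins if at some point she has claimed all six edges of a copy of $K_4$ in $K_n$. Breaker wins if he has claimed at least one edge of each copy of $K_4$ in $K_n$. The threshold bias $q_{K_4}(n)$ is the smallest non-negative integer $q$ such that Breaker has a winning strategy in this game. Here $e$ denotes Euler's number. *)

theory Defs
  imports Complex_Main "HOL-Library.Ramsey"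
begin

text \<open>
  The complete graph on a vertex set \<open>V\<close> is represented by its edge set, the 2-element subsets of
  \<open>V\<close>. The board of the game is \<open>edges {..<n}\<close>, and the copies of \<open>K\<^sub>4\<close> in \<open>K\<^sub>n\<close> are the sets
  \<open>edges W\<close> with \<open>W\<close> a 4-element subset of \<open>{..<n}\<close>.
\<close>

type_synonym edge = "nat set"

abbreviation edges :: "nat set \<Rightarrow> edge set" where
  "edges V \<equiv> nsets V 2"

text \<open>
  A round consists of Maker's edge and the set of edges with which Breaker answers; a history is
  the list of the completed rounds in chronological order.
\<close>

type_synonym round = "edge \<times> edge set"
type_synonym history = "round list"

definition maker_edges :: "history \<Rightarrow> edge set" where
  "maker_edges h = fst ` set h"

definition breaker_edges :: "history \<Rightarrow> edge set" where
  "breaker_edges h = \<Union> (snd ` set h)"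

definition unclaimed :: "nat \<Rightarrow> history \<Rightarrow> edge set" where
  "unclaimed n h = edges {..<n} - (maker_edges h \<union> breaker_edges h)"

text \<open>
  A strategy of Breaker may depend on the full history and on the edge Maker has just claimed.
\<close>

type_synonym strategy = "history \<Rightarrow> edge \<Rightarrow> edge set"

text \<open>The histories that can arise on \<open>K\<^sub>n\<close>, for arbitrary play of Maker, when Breaker follows \<open>S\<close>:\<close>

inductive consistent :: "nat \<Rightarrow> strategy \<Rightarrow> history \<Rightarrow> bool" for n S where
  start: "consistent n S []"
| round: "consistent n S h \<Longrightarrow> e \<in> unclaimed n h \<Longrightarrow> consistent n S (h @ [(e, S h e)])"

text \<open>
  The \<open>min\<close> accounts for the last round: if fewer than \<open>q\<close> unclaimed edges remain, Breaker claims
  all of them (possibly none).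
\<close>

definition legal_strategy :: "nat \<Rightarrow> nat \<Rightarrow> strategy \<Rightarrow> bool" where
  "legal_strategy n q S \<longleftrightarrow>
     (\<forall>h e. consistent n S h \<longrightarrow> e \<in> unclaimed n h \<longrightarrow>
        S h e \<subseteq> unclaimed n h - {e} \<and> card (S h e) = min q (card (unclaimed n h - {e})))"

definition breaker_won :: "nat \<Rightarrow> history \<Rightarrow> bool" where
  "breaker_won n h \<longleftrightarrow> (\<forall>W \<in> nsets {..<n} 4. edges W \<inter> breaker_edges h \<noteq> {})"

text \<open>
  The game is played until all edges are claimed. At that point, a copy of \<open>K\<^sub>4\<close> in which Breaker
  has no edge is one that Maker has claimed completely, so exactly one of the players has won.
\<close>

definition winning_strategy :: "nat \<Rightarrow> nat \<Rightarrow> strategy \<Rightarrow> bool" where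
  "winning_strategy n q S \<longleftrightarrow>
     legal_strategy n q S \<and>
     (\<forall>h. consistent n S h \<longrightarrow> unclaimed n h = {} \<longrightarrow> breaker_won n h)"

definition threshold_bias_K4 :: "nat \<Rightarrow> nat" where
  "threshold_bias_K4 n = (LEAST q. \<exists>S. winning_strategy n q S)"

end

theory Submission
  imports Defs "HOL-Real_Asymp.Real_Asymp"
begin

text \<open>
  Breaker splits his bias as \<open>q = q\<^sub>1 + p\<close>. With \<open>p\<close> edges per round he plays greedily for Beck's
  potential, in which a star pair (the edges joining two fixed vertices to a \<open>k\<close>-set) without Breaker
  edge and with \<open>j\<close> edges not yet claimed by Maker has weight \<open>(1 + p)\<^sup>-\<^sup>j\<close>. If
  \<open>n\<^sup>2 (n choose k) (1 + p)\<^bsup>1 - 2k\<^esup> < 1\<close>, no two vertices ever have more than \<open>k\<close> common neighbours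
  in Maker's graph. Then each edge of Maker creates at most \<open>(k choose 2) + 2 k\<^sup>2 \<le> 5 k\<^sup>2 / 2\<close> threats,
  i.e. edges completing a \<open>K\<^sub>4\<close> otherwise owned by Maker, and with \<open>q\<^sub>1 = 5 k\<^sup>2 / 2\<close> further edges
  Breaker claims all of them at once. Since \<open>n choose k \<le> (e n / k)\<^sup>k\<close>, the requirement is
  \<open>k p\<^sup>2 > e n\<close> up to lower-order terms; minimising \<open>5 k\<^sup>2 / 2 + p\<close> under it gives \<open>p = 4 q / 5\<close>
  and the constant.
\<close>

section \<open>Beck's potential for a finite family of sets\<close>

locale weighted_family =
  fixes I :: "'i set" and F :: "'i \<Rightarrow> 'a set" and p :: nat
  assumes finite_I: "finite I" and finite_F: "\<And>i. i \<in> I \<Longrightarrow> finite (F i)"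
begin

definition pot :: "'a set \<Rightarrow> 'a set \<Rightarrow> real" where
  "pot M B = (\<Sum>i | i \<in> I \<and> F i \<inter> B = {}. (1 / (1 + real p)) ^ card (F i - M))"

text \<open>The potential drops by this amount when Breaker claims \<open>e\<close>, and rises by
  \<open>p\<close> times this amount when Maker does.\<close>

definition wt :: "'a set \<Rightarrow> 'a set \<Rightarrow> 'a \<Rightarrow> real" where
  "wt M B e = (\<Sum>i | i \<in> I \<and> F i \<inter> B = {} \<and> e \<in> F i. (1 / (1 + real p)) ^ card (F i - M))"

lemma wt_nonneg: "0 \<le> wt M B e"
  unfolding wt_def by (intro sum_nonneg) auto

lemma pot_antimono: "B \<subseteq> B' \<Longrightarrow> pot M B' \<le> pot M B"
  unfolding pot_def using finite_I by (intro sum_mono2) auto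

lemma wt_antimono: "B \<subseteq> B' \<Longrightarrow> wt M B' e \<le> wt M B e"
  unfolding wt_def using finite_I by (intro sum_mono2) auto

lemma pot_insert_breaker: "pot M (insert e B) = pot M B - wt M B e"
proof -
  have "{i. i \<in> I \<and> F i \<inter> B = {}} =
      {i. i \<in> I \<and> F i \<inter> insert e B = {}} \<union> {i. i \<in> I \<and> F i \<inter> B = {} \<and> e \<in> F i}"
    by auto
  then have "pot M B = pot M (insert e B) + wt M B e"
    unfolding pot_def wt_def using finite_I by (simp only:) (intro sum.union_disjoint; auto)
  then show ?thesis by simp
qed

text \<open>Each surviving set through \<open>e\<close> has one missing element fewer, so its weight
  is multiplied by \<open>1 + p\<close>; the other weights stay.\<close>

lemma pot_insert_maker:
  assumes "e \<notin> M"
  shows "pot (insert e M) B = pot M B + real p * wt M B e"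
proof -
  define w where "w = 1 / (1 + real p)"
  have step: "w ^ card (F i - insert e M) =
      w ^ card (F i - M) + (if e \<in> F i then real p * w ^ card (F i - M) else 0)" if "i \<in> I" for i
  proof (cases "e \<in> F i")
    case True
    then have "F i - M = insert e (F i - insert e M)" using assms by auto
    moreover have "finite (F i - insert e M)" using finite_F[OF that] by auto
    ultimately have "card (F i - M) = Suc (card (F i - insert e M))"
      by (metis Diff_iff card_insert_disjoint insertI1)
    moreover have "w * (1 + real p) = 1" unfolding w_def by simp
    ultimately show ?thesis using True by (simp add: algebra_simps) (metis distrib_left mult.assoc mult.commute mult_1)
  next
    case False
    then have "F i - insert e M = F i - M" by auto
    then show ?thesis using False by simp
  qed
  have "{i. i \<in> I \<and> F i \<inter> B = {} \<and> e \<in> F i} = {i \<in> {i. i \<in> I \<and> F i \<inter> B = {}}. e \<in> F i}"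
    by auto
  moreover have "finite {i. i \<in> I \<and> F i \<inter> B = {}}" using finite_I by auto
  ultimately have "real p * wt M B e =
      (\<Sum>i | i \<in> I \<and> F i \<inter> B = {}. if e \<in> F i then real p * w ^ card (F i - M) else 0)"
    unfolding wt_def w_def by (simp only: sum.inter_filter sum_distrib_left) (simp cong: if_cong add: if_distrib)
  then show ?thesis
    unfolding pot_def using step by (simp add: w_def flip: sum.distrib)
qed

lemma wt_le_pot: "wt M B e \<le> pot M B"
  unfolding wt_def pot_def using finite_I by (intro sum_mono2) auto

lemma one_le_pot:
  assumes "i \<in> I" "F i \<subseteq> M" "F i \<inter> B = {}"
  shows "1 \<le> pot M B"
proof -
  have "F i - M = {}" using assms by auto
  then have "1 = (1 / (1 + real p)) ^ card (F i - M)" by (simp only: card.empty power_0)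
  also have "\<dots> \<le> pot M B"
    unfolding pot_def using assms finite_I by (intro member_le_sum) auto
  finally show ?thesis .
qed

lemma pot_empty:
  assumes "\<And>i. i \<in> I \<Longrightarrow> card (F i) = m"
  shows "pot {} {} = real (card I) / (1 + real p) ^ m"
proof -
  have "pot {} {} = (\<Sum>i\<in>I. (1 / (1 + real p)) ^ m)"
    unfolding pot_def using assms by (intro sum.cong) auto
  then show ?thesis by (simp add: power_divide)
qed

text \<open>Breaker takes an element of largest current weight \<open>m\<close> times. Each choice
  lowers the potential by its weight, which is at least the final weight of any element left over,
  since weights only shrink as \<open>B\<close> grows.\<close>

lemma ex_greedy:
  assumes "finite U" "m \<le> card U"
  shows "\<exists>T\<subseteq>U. card T = m \<and> (\<forall>e\<in>U - T. pot M (B \<union> T) + real m * wt M (B \<union> T) e \<le> pot M B)"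
  using assms(2)
proof (induction m)
  case 0
  show ?case by (intro exI[of _ "{}"]) auto
next
  case (Suc m)
  then obtain T where T: "T \<subseteq> U" "card T = m"
    and IH: "\<And>e. e \<in> U - T \<Longrightarrow> pot M (B \<union> T) + real m * wt M (B \<union> T) e \<le> pot M B"
    by auto
  have "finite (U - T)" using assms(1) by auto
  moreover have "U - T \<noteq> {}" using T Suc.prems by auto
  ultimately have "Max (wt M (B \<union> T) ` (U - T)) \<in> wt M (B \<union> T) ` (U - T)"
    by (intro Max_in) auto
  then obtain f where f: "f \<in> U - T"
    and f_Max: "wt M (B \<union> T) f = Max (wt M (B \<union> T) ` (U - T))"
    by (metis imageE)
  have max: "wt M (B \<union> T) e \<le> wt M (B \<union> T) f" if "e \<in> U - T" for e
    unfolding f_Max using that assms(1) by (intro Max_ge) auto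
  have "card (insert f T) = Suc m"
    using f T assms(1) by (simp add: finite_subset)
  moreover have "pot M (B \<union> insert f T) + real (Suc m) * wt M (B \<union> insert f T) e \<le> pot M B"
    if e: "e \<in> U - insert f T" for e
  proof -
    have "wt M (B \<union> insert f T) e \<le> wt M (B \<union> T) e"
      by (intro wt_antimono) auto
    then have "real (Suc m) * wt M (B \<union> insert f T) e \<le> real (Suc m) * wt M (B \<union> T) e"
      by (intro mult_left_mono) auto
    also have "\<dots> = real m * wt M (B \<union> T) e + wt M (B \<union> T) e"
      by (simp add: algebra_simps)
    also have "\<dots> \<le> real m * wt M (B \<union> T) e + wt M (B \<union> T) f"
      using max e by auto
    finally show ?thesis using IH[of e] e pot_insert_breaker[of M f "B \<union> T"] by auto
  qed
  ultimately show ?case using f T by (intro exI[of _ "insert f T"]) auto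
qed

text \<open>\<open>D\<close> holds the forced replies; the remaining elements, at least
  \<open>p\<close> of them, are chosen greedily. By \<open>pot_insert_maker\<close>, the last clause
  keeps Maker's next move from lifting the potential above its value before this reply. If at most
  \<open>q\<close> elements are left, Breaker takes all and that clause is vacuous.\<close>

lemma ex_response:
  assumes "finite U" "D \<subseteq> U" "card D + p \<le> q"
  shows "\<exists>A\<subseteq>U. D \<subseteq> A \<and> card A = min q (card U) \<and>
    (\<forall>e\<in>U - A. pot M (B \<union> A) + real p * wt M (B \<union> A) e \<le> pot M B)"
proof (cases "card U \<le> q")
  case True
  then show ?thesis using assms by (intro exI[of _ U]) auto
next
  case False
  have fin: "finite D" using assms finite_subset by blast
  have "q - card D \<le> card (U - D)"
    using False assms fin by (simp add: card_Diff_subset)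
  then obtain T where T: "T \<subseteq> U - D" "card T = q - card D"
    and le: "\<And>e. e \<in> U - D - T \<Longrightarrow>
      pot M (B \<union> D \<union> T) + real (q - card D) * wt M (B \<union> D \<union> T) e \<le> pot M (B \<union> D)"
    using ex_greedy[of "U - D" "q - card D" M "B \<union> D"] assms by blast
  have "card (D \<union> T) = q"
    using T fin assms by (subst card_Un_disjoint) (auto intro: finite_subset)
  moreover have "pot M (B \<union> (D \<union> T)) + real p * wt M (B \<union> (D \<union> T)) e \<le> pot M B"
    if e: "e \<in> U - (D \<union> T)" for e
  proof -
    have "real p * wt M (B \<union> D \<union> T) e \<le> real (q - card D) * wt M (B \<union> D \<union> T) e"
      using assms wt_nonneg by (intro mult_right_mono) auto
    moreover have "pot M (B \<union> D) \<le> pot M B" by (intro pot_antimono) auto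
    ultimately show ?thesis using le[of e] e by (simp add: Un_assoc)
  qed
  ultimately show ?thesis using T False assms by (intro exI[of _ "D \<union> T"]) auto
qed

end

section \<open>Threats and common neighbours\<close>

definition common_nbrs :: "edge set \<Rightarrow> nat \<Rightarrow> nat \<Rightarrow> nat set" where
  "common_nbrs M u v = {x. {u, x} \<in> M \<and> {v, x} \<in> M}"

text \<open>\<open>f\<close> is meant to be Maker's latest edge. A threat may already be answered by
  Breaker; \<open>good_response\<close> intersects with the unclaimed edges.\<close>

definition threats :: "edge set \<Rightarrow> edge \<Rightarrow> edge set" where
  "threats M f = {e. e \<notin> M \<and> (\<exists>W. card W = 4 \<and> {e, f} \<subseteq> edges W \<and> edges W - {e} \<subseteq> M)}"

lemma doubleton_mem_edges_iff: "{a, b} \<in> edges W \<longleftrightarrow> a \<noteq> b \<and> a \<in> W \<and> b \<in> W"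
  by (auto simp: nsets_def card_insert_if)

lemma finite_common_nbrs:
  assumes "M \<subseteq> edges {..<n}"
  shows "finite (common_nbrs M u v)"
  by (rule finite_subset[of _ "{..<n}"])
    (use assms in \<open>auto simp: common_nbrs_def nsets_def\<close>)

text \<open>In a K4 on \<open>{u, v, x, y}\<close> the missing edge is either \<open>{x, y}\<close>,
  opposite to \<open>f\<close>, and then \<open>x\<close> and \<open>y\<close> are common neighbours
  of \<open>u\<close> and \<open>v\<close>; or it meets \<open>f\<close>, say it is
  \<open>{u, x}\<close>, and then \<open>y\<close> is a common neighbour of \<open>u\<close> and
  \<open>v\<close>, and \<open>x\<close> one of \<open>v\<close> and \<open>y\<close>.\<close>

lemma threats_subset:
  assumes f: "f = {u, v}" "f \<in> M"
  shows "threats M f \<subseteq> edges (common_nbrs M u v)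
    \<union> (\<Union>y\<in>common_nbrs M u v. (\<lambda>x. {u, x}) ` common_nbrs M v y)
    \<union> (\<Union>y\<in>common_nbrs M u v. (\<lambda>x. {v, x}) ` common_nbrs M u y)"
proof
  fix e assume "e \<in> threats M f"
  then obtain W where e: "e \<notin> M" and W: "card W = 4" "e \<in> edges W" "f \<in> edges W"
    and sub: "edges W - {e} \<subseteq> M"
    unfolding threats_def by auto
  have uv: "u \<noteq> v" "u \<in> W" "v \<in> W" using W(3) f by (auto simp: doubleton_mem_edges_iff)
  have "finite W" using W(1) card.infinite by fastforce
  then have "card (W - {u, v}) = 2" using uv W(1) by (simp add: card_Diff_subset)
  then obtain x y where xy: "W - {u, v} = {x, y}" "x \<noteq> y" by (auto simp: card_2_iff)
  have W_eq: "W = {u, v, x, y}" and dist: "x \<noteq> u" "x \<noteq> v" "y \<noteq> u" "y \<noteq> v"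
    using xy uv by auto
  obtain a b where ab: "e = {a, b}" "a \<noteq> b" "a \<in> W" "b \<in> W"
    using W(2) by (auto simp: nsets_def card_2_iff)
  have M: "{c, d} \<in> M" if "c \<in> W" "d \<in> W" "c \<noteq> d" "{c, d} \<noteq> e" for c d
    using that sub doubleton_mem_edges_iff by blast
  have edges_M: "{u, x} \<noteq> e \<Longrightarrow> {u, x} \<in> M" "{u, y} \<noteq> e \<Longrightarrow> {u, y} \<in> M"
    "{v, x} \<noteq> e \<Longrightarrow> {v, x} \<in> M" "{v, y} \<noteq> e \<Longrightarrow> {v, y} \<in> M"
    "{x, y} \<noteq> e \<Longrightarrow> {x, y} \<in> M" "{y, x} \<noteq> e \<Longrightarrow> {y, x} \<in> M"
    using dist xy(2) W_eq by (intro M; simp)+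
  have "e \<noteq> {u, v}" using e f by auto
  then consider "e = {x, y}" | "e = {u, x}" | "e = {u, y}" | "e = {v, x}" | "e = {v, y}"
    using ab W_eq by (auto simp: insert_commute)
  then show "e \<in> edges (common_nbrs M u v)
    \<union> (\<Union>y\<in>common_nbrs M u v. (\<lambda>x. {u, x}) ` common_nbrs M v y)
    \<union> (\<Union>y\<in>common_nbrs M u v. (\<lambda>x. {v, x}) ` common_nbrs M u y)"
  proof cases
    case 1
    then have "x \<in> common_nbrs M u v" "y \<in> common_nbrs M u v"
      unfolding common_nbrs_def using dist uv xy(2) edges_M by (simp_all add: doubleton_eq_iff)
    then show ?thesis using 1 xy(2) by (simp add: doubleton_mem_edges_iff)
  next
    case 2
    then have "y \<in> common_nbrs M u v" "x \<in> common_nbrs M v y"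
      unfolding common_nbrs_def using dist uv xy(2) edges_M by (simp_all add: doubleton_eq_iff)
    then show ?thesis using 2 by blast
  next
    case 3
    then have "x \<in> common_nbrs M u v" "y \<in> common_nbrs M v x"
      unfolding common_nbrs_def using dist uv xy(2) edges_M by (simp_all add: doubleton_eq_iff)
    then show ?thesis using 3 by blast
  next
    case 4
    then have "y \<in> common_nbrs M u v" "x \<in> common_nbrs M u y"
      unfolding common_nbrs_def using dist uv xy(2) edges_M by (simp_all add: doubleton_eq_iff)
    then show ?thesis using 4 by blast
  next
    case 5
    then have "x \<in> common_nbrs M u v" "y \<in> common_nbrs M u x"
      unfolding common_nbrs_def using dist uv xy(2) edges_M by (simp_all add: doubleton_eq_iff)
    then show ?thesis using 5 by blast
  qed
qed

lemma finite_threats: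
  assumes M: "M \<subseteq> edges {..<n}" and f: "f \<in> M"
  shows "finite (threats M f)"
proof -
  obtain u v where "f = {u, v}"
    using f M by (auto simp: nsets_def card_2_iff)
  from threats_subset[OF this f] show ?thesis
    by (rule finite_subset) (auto intro!: finite_imp_finite_nsets finite_common_nbrs[OF M])
qed

text \<open>Threats opposite to \<open>f\<close> are pairs of common neighbours of its ends. For a
  threat at a given end of \<open>f\<close> there are at most \<open>k\<close> choices for
  \<open>y\<close> and then \<open>k\<close> for \<open>x\<close>; the two ends give
  \<open>2 * k^2\<close>.\<close>

lemma card_threats_le:
  assumes M: "M \<subseteq> edges {..<n}" and f: "f \<in> M"
    and k: "\<And>a b. a \<noteq> b \<Longrightarrow> card (common_nbrs M a b) \<le> k"
  shows "card (threats M f) \<le> (k choose 2) + 2 * k\<^sup>2"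
proof -
  obtain u v where uv: "f = {u, v}" "u \<noteq> v"
    using f M by (auto simp: nsets_def card_2_iff)
  define N where "N = common_nbrs M u v"
  have fin: "finite (common_nbrs M a b)" for a b
    using finite_common_nbrs[OF M] .
  \<comment> \<open>Edges have two distinct vertices, so \<open>y\<close> differs from both ends of
    \<open>f\<close> and the hypothesis on distinct vertices applies to \<open>d\<close> and
    \<open>y\<close>.\<close>
  have nbr: "y \<noteq> u \<and> y \<noteq> v" if "y \<in> N" for y
    using that M unfolding N_def common_nbrs_def by (auto simp: nsets_def)
  have star: "card (\<Union>y\<in>N. (\<lambda>x. {c, x}) ` common_nbrs M d y) \<le> k\<^sup>2"
    if "d \<in> {u, v}" for c d
  proof -
    have "card (\<Union>y\<in>N. (\<lambda>x. {c, x}) ` common_nbrs M d y)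
        \<le> (\<Sum>y\<in>N. card ((\<lambda>x. {c, x}) ` common_nbrs M d y))"
      using fin N_def by (intro card_UN_le) auto
    also have "\<dots> \<le> (\<Sum>y\<in>N. k)"
    proof (intro sum_mono)
      fix y assume "y \<in> N"
      then have "card (common_nbrs M d y) \<le> k" using that nbr by (intro k) auto
      then show "card ((\<lambda>x. {c, x}) ` common_nbrs M d y) \<le> k"
        using card_image_le[OF fin] le_trans by blast
    qed
    also have "\<dots> \<le> k\<^sup>2" using k[OF uv(2)] by (simp add: N_def power2_eq_square)
    finally show ?thesis .
  qed
  have "card (edges N) \<le> k choose 2"
    using k[OF uv(2)] by (simp add: N_def binomial_right_mono)
  moreover have "card (threats M f) \<le> card (edges N
    \<union> (\<Union>y\<in>N. (\<lambda>x. {u, x}) ` common_nbrs M v y) \<union> (\<Union>y\<in>N. (\<lambda>x. {v, x}) ` common_nbrs M u y))"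
    using threats_subset[OF uv(1) f] fin finite_imp_finite_nsets[OF fin] unfolding N_def
    by (intro card_mono) auto
  moreover have "\<dots> \<le> card (edges N) + card (\<Union>y\<in>N. (\<lambda>x. {u, x}) ` common_nbrs M v y)
      + card (\<Union>y\<in>N. (\<lambda>x. {v, x}) ` common_nbrs M u y)"
    by (meson add_le_mono1 card_Un_le le_trans)
  ultimately show ?thesis using star[of v u] star[of u v] by simp
qed

section \<open>Star pairs and codegrees in Maker's graph\<close>

definition star_pairs :: "nat \<Rightarrow> nat \<Rightarrow> (nat \<times> nat \<times> nat set) set" where
  "star_pairs n k = {(u, v, S). u < n \<and> v < n \<and> u \<noteq> v \<and> S \<in> nsets ({..<n} - {u, v}) k}"

definition star_pair_edges :: "nat \<times> nat \<times> nat set \<Rightarrow> edge set" where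
  "star_pair_edges = (\<lambda>(u, v, S). (\<lambda>x. {u, x}) ` S \<union> (\<lambda>x. {v, x}) ` S)"

lemma star_pairs_subset: "star_pairs n k \<subseteq> {..<n} \<times> {..<n} \<times> nsets {..<n} k"
  by (auto simp: star_pairs_def nsets_def)

text \<open>A crude count: a polynomial factor such as \<open>n^2\<close> is harmless against the
  later exponential decay of \<open>r ^ k\<close>.\<close>

lemma card_star_pairs_le: "card (star_pairs n k) \<le> n\<^sup>2 * (n choose k)"
proof -
  have "card (star_pairs n k) \<le> card ({..<n} \<times> {..<n} \<times> nsets {..<n} k)"
    by (intro card_mono star_pairs_subset) (auto intro: finite_imp_finite_nsets)
  then show ?thesis by (simp add: card_cartesian_product power2_eq_square mult.assoc)
qed

lemma card_star_pair_edges: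
  assumes "i \<in> star_pairs n k"
  shows "card (star_pair_edges i) = 2 * k"
proof -
  obtain u v S where i: "i = (u, v, S)" and uv: "u \<noteq> v" "u \<notin> S" "v \<notin> S"
    and S: "finite S" "card S = k"
    using assms by (auto simp: star_pairs_def nsets_def)
  have "inj_on (\<lambda>x. {u, x}) S" "inj_on (\<lambda>x. {v, x}) S"
    by (auto simp: inj_on_def doubleton_eq_iff)
  moreover have "(\<lambda>x. {u, x}) ` S \<inter> (\<lambda>x. {v, x}) ` S = {}"
    using uv by (auto simp: doubleton_eq_iff)
  ultimately show ?thesis
    using S by (simp add: i star_pair_edges_def card_Un_disjoint card_image)
qed

interpretation star: weighted_family "star_pairs n k" star_pair_edges p for n k p
proof
  show "finite (star_pairs n k)"
    by (rule finite_subset[OF star_pairs_subset]) (auto intro: finite_imp_finite_nsets)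
  show "finite (star_pair_edges i)" if "i \<in> star_pairs n k" for i
    using that by (auto simp: star_pairs_def star_pair_edges_def nsets_def)
qed

text \<open>Otherwise some \<open>k\<close> common neighbours would form a star pair owned by Maker,
  which alone has weight 1.\<close>

lemma card_common_nbrs_le:
  assumes M: "M \<subseteq> edges {..<n}" and "M \<inter> B = {}" and "a \<noteq> b" and pot: "star.pot n k p M B < 1"
  shows "card (common_nbrs M a b) \<le> k"
proof (rule ccontr)
  assume "\<not> card (common_nbrs M a b) \<le> k"
  \<comment> \<open>The existence of a common neighbour puts \<open>a\<close> and \<open>b\<close>
    below \<open>n\<close> even if \<open>k = 0\<close>, when \<open>S\<close> is empty.\<close>
  then have "k \<le> card (common_nbrs M a b)" "common_nbrs M a b \<noteq> {}" by auto
  moreover obtain S where S: "S \<subseteq> common_nbrs M a b" "card S = k" "finite S"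
    using calculation obtain_subset_with_card_n by metis
  ultimately have "(a, b, S) \<in> star_pairs n k"
    using M \<open>a \<noteq> b\<close> by (auto simp: star_pairs_def nsets_def common_nbrs_def)
  moreover have "star_pair_edges (a, b, S) \<subseteq> M"
    using S by (auto simp: star_pair_edges_def common_nbrs_def)
  ultimately show False using star.one_le_pot[of "(a, b, S)" n k M B p] assms by fastforce
qed

section \<open>Breaker's strategy and its invariant\<close>

lemma maker_edges_snoc [simp]: "maker_edges (h @ [(e, A)]) = insert e (maker_edges h)"
  by (auto simp: maker_edges_def)

lemma breaker_edges_snoc [simp]: "breaker_edges (h @ [(e, A)]) = breaker_edges h \<union> A"
  by (auto simp: breaker_edges_def)

lemma unclaimed_snoc: "unclaimed n (h @ [(e, A)]) = unclaimed n h - {e} - A"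
  by (auto simp: unclaimed_def)

lemma finite_unclaimed: "finite (unclaimed n h)"
  by (simp add: unclaimed_def finite_imp_finite_nsets)

text \<open>The invariant between rounds. The potential is bounded after one more edge of Maker, the
  moment at which Breaker replies. In the last clause \<open>e\<close> may itself be Maker's, so
  together with disjointness it also forbids a complete K4 of Maker.\<close>

definition safe :: "nat \<Rightarrow> nat \<Rightarrow> nat \<Rightarrow> history \<Rightarrow> bool" where
  "safe n k p h \<longleftrightarrow>
     maker_edges h \<subseteq> edges {..<n} \<and> maker_edges h \<inter> breaker_edges h = {} \<and>
     (\<forall>e\<in>unclaimed n h. star.pot n k p (insert e (maker_edges h)) (breaker_edges h) < 1) \<and>
     (\<forall>W e. card W = 4 \<longrightarrow> W \<subseteq> {..<n} \<longrightarrow> e \<in> edges W \<longrightarrow> edges W - {e} \<subseteq> maker_edges h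
        \<longrightarrow> e \<in> breaker_edges h)"

definition good_response :: "nat \<Rightarrow> nat \<Rightarrow> nat \<Rightarrow> nat \<Rightarrow> history \<Rightarrow> edge \<Rightarrow> edge set \<Rightarrow> bool" where
  "good_response n k p q h e A \<longleftrightarrow>
     (let U = unclaimed n h - {e}; M = insert e (maker_edges h); B = breaker_edges h in
       A \<subseteq> U \<and> card A = min q (card U) \<and> threats M e \<inter> U \<subseteq> A \<and>
       (\<forall>e'\<in>U - A. star.pot n k p M (B \<union> A) + real p * star.wt n k p M (B \<union> A) e'
          \<le> star.pot n k p M B))"

text \<open>After Maker's edge \<open>e\<close> the potential is still below 1, so codegrees are at
  most \<open>k\<close>, and answering all threats leaves at least \<open>p\<close> of the
  \<open>q\<close> edges for the greedy part.\<close>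

lemma ex_good_response:
  assumes safe: "safe n k p h" and e: "e \<in> unclaimed n h" and q: "(k choose 2) + 2 * k\<^sup>2 + p \<le> q"
  shows "\<exists>A. good_response n k p q h e A"
proof -
  define M where "M = insert e (maker_edges h)"
  define U where "U = unclaimed n h - {e}"
  have M: "M \<subseteq> edges {..<n}" "M \<inter> breaker_edges h = {}"
    using safe e by (auto simp: safe_def M_def unclaimed_def)
  have "card (common_nbrs M a b) \<le> k" if "a \<noteq> b" for a b
    using card_common_nbrs_le[OF M that] safe e by (auto simp: safe_def M_def)
  then have threats_le: "card (threats M e) \<le> (k choose 2) + 2 * k\<^sup>2"
    using M by (intro card_threats_le) (auto simp: M_def)
  have "finite (threats M e)" using M by (intro finite_threats) (auto simp: M_def)
  then have "card (threats M e \<inter> U) \<le> card (threats M e)" by (intro card_mono) auto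
  then have "card (threats M e \<inter> U) + p \<le> q" using threats_le q by linarith
  then show ?thesis
    using star.ex_response[of U "threats M e \<inter> U" p q n k M "breaker_edges h"] finite_unclaimed
    unfolding good_response_def Let_def M_def[symmetric] U_def[symmetric]
    by (simp add: U_def) blast
qed

text \<open>The greedy choice preserves the bound on the potential. A K4 that newly lacks just one
  edge contains \<open>e\<close>, so its missing edge is a threat, which Breaker now answers or
  already owns.\<close>

lemma safe_snoc:
  assumes safe: "safe n k p h" and e: "e \<in> unclaimed n h" and A: "good_response n k p q h e A"
  shows "safe n k p (h @ [(e, A)])"
proof -
  define M where "M = insert e (maker_edges h)"
  define B where "B = breaker_edges h"
  define U where "U = unclaimed n h - {e}"
  have A: "A \<subseteq> U" "threats M e \<inter> U \<subseteq> A"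
    and pot_le: "\<And>e'. e' \<in> U - A \<Longrightarrow>
      star.pot n k p M (B \<union> A) + real p * star.wt n k p M (B \<union> A) e' \<le> star.pot n k p M B"
    using A unfolding good_response_def Let_def M_def B_def U_def by auto
  have old: "\<And>W e. card W = 4 \<Longrightarrow> W \<subseteq> {..<n} \<Longrightarrow> e \<in> edges W \<Longrightarrow> edges W - {e} \<subseteq> maker_edges h
      \<Longrightarrow> e \<in> B"
    using safe by (auto simp: safe_def B_def)
  have "M \<subseteq> edges {..<n}" "M \<inter> (B \<union> A) = {}"
    using safe e A by (auto simp: safe_def M_def B_def U_def unclaimed_def)
  moreover have "star.pot n k p (insert e' M) (B \<union> A) < 1" if "e' \<in> U - A" for e'
  proof -
    have "e' \<notin> M" using that by (auto simp: U_def M_def unclaimed_def)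
    then have "star.pot n k p (insert e' M) (B \<union> A) \<le> star.pot n k p M B"
      using pot_le[OF that] star.pot_insert_maker by simp
    also have "\<dots> < 1" using safe e by (auto simp: safe_def M_def B_def)
    finally show ?thesis .
  qed
  moreover have "g \<in> B \<union> A"
    if W: "card W = 4" "W \<subseteq> {..<n}" and g: "g \<in> edges W" and sub: "edges W - {g} \<subseteq> M" for W g
  proof (cases "e \<in> edges W - {g}")
    case False
    then show ?thesis using old[OF W g] sub by (auto simp: M_def)
  next
    case True
    \<comment> \<open>Otherwise \<open>W\<close> would have lacked only \<open>e\<close> before this
      round, and \<open>e\<close> would already be Breaker's.\<close>
    have "g \<notin> maker_edges h"
    proof
      assume "g \<in> maker_edges h"
      then have "e \<in> B" using True sub by (intro old[OF W]) (auto simp: M_def)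
      then show False using e by (auto simp: B_def unclaimed_def)
    qed
    then have "g \<notin> M" using True by (auto simp: M_def)
    then have "g \<in> threats M e"
      using W(1) g sub True by (auto simp: threats_def)
    moreover have "g \<in> edges {..<n}" using g W(2) by (auto simp: nsets_def)
    ultimately show ?thesis using A \<open>g \<notin> M\<close> by (auto simp: U_def M_def B_def unclaimed_def)
  qed
  ultimately show ?thesis
    unfolding safe_def unclaimed_snoc by (auto simp: M_def B_def U_def)
qed

text \<open>Maker moves first, and her first edge multiplies the potential by at most
  \<open>1 + p\<close>.\<close>

lemma safe_Nil:
  assumes "star.pot n k p {} {} * (1 + real p) < 1"
  shows "safe n k p []"
proof -
  have "star.pot n k p {e} {} < 1" for e
    using star.pot_insert_maker[of e "{}" n k p "{}"] star.wt_le_pot[of n k p "{}" "{}" e] assms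
      mult_left_mono[of "star.wt n k p {} {} e" "star.pot n k p {} {}" "real p"]
    by (simp add: algebra_simps)
  moreover have "\<not> edges W \<subseteq> {e}" if "card W = 4" for W e
  proof
    assume "edges W \<subseteq> {e}"
    moreover have "card (edges W) = 6"
      using that by (simp add: choose_two)
    ultimately show False
      using card_mono[of "{e}" "edges W"] by simp
  qed
  ultimately show ?thesis by (auto simp: safe_def maker_edges_def breaker_edges_def)
qed

lemma ex_winning_strategy:
  assumes pot: "star.pot n k p {} {} * (1 + real p) < 1" and q: "(k choose 2) + 2 * k\<^sup>2 + p \<le> q"
  shows "\<exists>S. winning_strategy n q S"
proof -
  \<comment> \<open>On histories that are not safe \<open>S\<close> is arbitrary; the induction
    below shows that none of them is consistent with \<open>S\<close>.\<close>
  define S where "S h e = (SOME A. good_response n k p q h e A)" for h e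
  have good: "good_response n k p q h e (S h e)" if "safe n k p h" "e \<in> unclaimed n h" for h e
    unfolding S_def using ex_good_response[OF that q] by (rule someI_ex)
  have safe: "safe n k p h" if "consistent n S h" for h
    using that
  proof induction
    case start
    show ?case using safe_Nil[OF pot] .
  next
    case (round h e)
    then show ?case using safe_snoc good by blast
  qed
  have "legal_strategy n q S"
    unfolding legal_strategy_def using good safe by (auto simp: good_response_def Let_def)
  moreover have "breaker_won n h" if h: "consistent n S h" "unclaimed n h = {}" for h
    unfolding breaker_won_def
  proof
    fix W assume "W \<in> nsets {..<n} 4"
    then have W: "card W = 4" "W \<subseteq> {..<n}" by (auto simp: nsets_def)
    show "edges W \<inter> breaker_edges h \<noteq> {}"
    proof
      assume disj: "edges W \<inter> breaker_edges h = {}"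
      have "edges W \<subseteq> edges {..<n}" using W by (auto simp: nsets_def)
      then have sub: "edges W \<subseteq> maker_edges h" using disj h(2) by (auto simp: unclaimed_def)
      have "card (edges W) = 6" using W by (simp add: choose_two)
      \<comment> \<open>Any edge of \<open>W\<close> will do: the other five are Maker's, so the
        invariant assigns \<open>g\<close> to Breaker.\<close>
      then obtain g where "g \<in> edges W" by (metis all_not_in_conv card.empty zero_neq_numeral)
      moreover have "g \<in> breaker_edges h"
        using safe[OF h(1)] W calculation sub unfolding safe_def by blast
      ultimately show False using disj by auto
    qed
  qed
  ultimately show ?thesis by (auto simp: winning_strategy_def)
qed

section \<open>Bound on the bias for given \<open>k\<close> and \<open>p\<close>\<close>

lemma power_le_exp_fact: "real k ^ k \<le> exp (real k) * fact k"
proof -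
  have "(\<lambda>i. real k ^ i /\<^sub>R fact i) sums exp (real k)"
    by (rule exp_converges)
  \<comment> \<open>A single term of a series of nonnegative terms is at most its sum.\<close>
  then have "(\<Sum>i\<in>{k}. real k ^ i /\<^sub>R fact i) \<le> exp (real k)"
    using sum_le_suminf[of "\<lambda>i. real k ^ i /\<^sub>R fact i" "{k}"]
    by (simp add: sums_iff)
  then have "real k ^ k / fact k \<le> exp (real k)" by (simp add: divide_inverse mult.commute)
  then show ?thesis by (simp add: field_simps)
qed

lemma binomial_le_exp_power:
  assumes "0 < k"
  shows "real (n choose k) \<le> (exp 1 * real n / real k) ^ k"
proof -
  have "real (n choose k) * fact k \<le> real n ^ k"
    using binomial_fact_pow[of n k] by (metis of_nat_fact of_nat_le_iff of_nat_mult of_nat_power)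
  then have "real (n choose k) * fact k * real k ^ k \<le> real n ^ k * (exp (real k) * fact k)"
    by (intro mult_mono power_le_exp_fact) auto
  then have "real (n choose k) * real k ^ k \<le> real n ^ k * exp (real k)"
    by simp
  then show ?thesis
    using assms by (simp add: power_divide power_mult_distrib field_simps flip: exp_of_nat_mult)
qed

text \<open>The initial potential is at most \<open>n^2 * r ^ k\<close>; the factor
  \<open>1 + p\<close> pays for Maker's first edge. The \<open>5 / 2\<close> is \<open>1 / 2\<close>
  from \<open>k choose 2\<close> plus the 2 from threats meeting Maker's edge.\<close>

lemma threshold_bias_le:
  assumes "0 < k"
    and r: "exp 1 * real n / (real k * (1 + real p)\<^sup>2) \<le> r"
    and small: "(real n)\<^sup>2 * (1 + real p) * r ^ k < 1"
  shows "real (threshold_bias_K4 n) \<le> 5 / 2 * (real k)\<^sup>2 + real p"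
proof -
  define q where "q = (k choose 2) + 2 * k\<^sup>2 + p"
  have "real (card (star_pairs n k)) \<le> (real n)\<^sup>2 * (exp 1 * real n / real k) ^ k"
  proof -
    have "real (card (star_pairs n k)) \<le> (real n)\<^sup>2 * real (n choose k)"
      using card_star_pairs_le[of n k] by (metis of_nat_le_iff of_nat_mult of_nat_power)
    also have "\<dots> \<le> (real n)\<^sup>2 * (exp 1 * real n / real k) ^ k"
      by (intro mult_left_mono binomial_le_exp_power assms) auto
    finally show ?thesis .
  qed
  then have "star.pot n k p {} {} \<le> (real n)\<^sup>2 * (exp 1 * real n / real k) ^ k / (1 + real p) ^ (2 * k)"
    by (subst star.pot_empty[OF card_star_pair_edges]) (auto intro: divide_right_mono)
  also have "\<dots> = (real n)\<^sup>2 * (exp 1 * real n / (real k * (1 + real p)\<^sup>2)) ^ k"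
    by (simp add: power_mult power_divide power_mult_distrib)
  also have "\<dots> \<le> (real n)\<^sup>2 * r ^ k"
    using r by (intro mult_left_mono power_mono) auto
  finally have "star.pot n k p {} {} * (1 + real p) \<le> (real n)\<^sup>2 * r ^ k * (1 + real p)"
    by (intro mult_right_mono) auto
  also have "\<dots> < 1" using small by (simp add: mult_ac)
  finally have "star.pot n k p {} {} * (1 + real p) < 1" .
  then have "\<exists>S. winning_strategy n q S"
    by (intro ex_winning_strategy[of n k p]) (auto simp: q_def)
  then have "threshold_bias_K4 n \<le> q"
    unfolding threshold_bias_K4_def by (rule Least_le)
  moreover have "real (k choose 2) \<le> (real k)\<^sup>2 / 2"
    using binomial_fact_pow[of k 2] by (simp add: fact_2 flip: of_nat_mult of_nat_power)
  moreover have "real q = real (k choose 2) + 2 * (real k)\<^sup>2 + real p"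
    by (simp add: q_def)
  ultimately show ?thesis by linarith
qed

section \<open>Choice of parameters and asymptotics\<close>

definition K4_const :: real where
  "K4_const = 5 powr (6/5) * 2 powr (-9/5) * exp 1 powr (2/5)"

lemma K4_const_pos: "0 < K4_const"
  by (simp add: K4_const_def)

text \<open>This is the critical equation \<open>k p^2 = e n\<close> at \<open>C = K4_const\<close>.
  Minimising \<open>5 k^2 / 2 + p\<close> for fixed \<open>k p^2\<close> gives
  \<open>p = 10 k^2\<close>; a total of \<open>C x^2\<close> with \<open>x = n^(1/5)\<close> then
  means \<open>k = sqrt (2 C / 25) x\<close> and \<open>p = 4 C x^2 / 5\<close>.\<close>

lemma K4_const_powr: "sqrt (2 / 25) * (16 / 25) * K4_const powr (5/2) = exp 1"
proof -
  have "K4_const powr (5/2) = 5 powr 3 * 2 powr (-9/2) * exp 1"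
    by (simp add: K4_const_def powr_mult powr_powr)
  also have "(2::real) powr (-9/2) = 2 powr (1/2) * 2 powr (-5)"
    by (simp flip: powr_add)
  also have "\<dots> = sqrt 2 / 32"
    by (simp add: powr_half_sqrt powr_minus)
  finally have K: "K4_const powr (5/2) = 125 * (sqrt 2 / 32) * exp 1"
    by simp
  have "sqrt (2 / 25) = sqrt 2 / 5" "sqrt 2 * sqrt 2 = (2::real)"
    by (simp_all add: real_sqrt_divide)
  then show ?thesis unfolding K by (simp add: algebra_simps)
qed

lemma eventually_threshold_bias_le:
  assumes "0 < \<delta>"
  shows "\<forall>\<^sub>F n in sequentially. real (threshold_bias_K4 n) \<le> (K4_const + \<delta>) * real n powr (2/5)"
proof -
  \<comment> \<open>Half of \<open>\<delta>\<close> makes \<open>r < 1\<close>, the other half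
    absorbs the rounding of \<open>k\<close> and \<open>p\<close>.\<close>
  define C where "C = K4_const + \<delta> / 2"
  define \<kappa> where "\<kappa> = sqrt (2 * C / 25)"
  \<comment> \<open>The value of \<open>e n / (k p^2)\<close> at \<open>k = \<kappa> x\<close>,
    \<open>p = 4 C x^2 / 5\<close> and \<open>n = x^5\<close>, where all powers of \<open>x\<close>
    cancel.\<close>
  define r where "r = exp 1 / (\<kappa> * (16 / 25 * C\<^sup>2))"
  have C: "0 < C" using assms K4_const_pos by (simp add: C_def)
  then have \<kappa>: "0 < \<kappa>" "\<kappa>\<^sup>2 = 2 * C / 25" by (auto simp: \<kappa>_def)
  have "exp 1 < sqrt (2 / 25) * (16 / 25) * C powr (5/2)"
    unfolding K4_const_powr[symmetric] using assms K4_const_pos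
    by (intro mult_strict_left_mono powr_less_mono2) (auto simp: C_def)
  also have "C powr (5/2) = sqrt C * C\<^sup>2"
    using C powr_add[of C "1/2" 2] by (simp add: powr_half_sqrt)
  also have "sqrt (2 / 25) * (16 / 25) * (sqrt C * C\<^sup>2) = \<kappa> * (16 / 25 * C\<^sup>2)"
    by (simp add: \<kappa>_def real_sqrt_divide real_sqrt_mult)
  finally have r: "0 < r" "r < 1" using C \<kappa> by (auto simp: r_def)
  define a where "a = - (\<kappa> * ln r)"
  have a: "0 < a" using r \<kappa> by (simp add: a_def mult_pos_neg)
  \<comment> \<open>Here \<open>x ^ 10\<close> is \<open>n^2\<close>, the bracket bounds
    \<open>1 + p\<close> with \<open>p\<close> rounded up, and the exponential is \<open>r\<close>
    to the power \<open>\<kappa> * x\<close>.\<close>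
  have "\<forall>\<^sub>F x in at_top. x ^ 10 * (2 + 4 / 5 * C * x\<^sup>2) * exp (- a * x) < 1"
    using a C by real_asymp
  moreover have "\<forall>\<^sub>F x in at_top. 5 / 2 * (\<kappa> * x + 1)\<^sup>2 + (4 / 5 * C * x\<^sup>2 + 1) \<le> (K4_const + \<delta>) * x\<^sup>2"
  proof -
    have "\<forall>\<^sub>F x in at_top. 5 * \<kappa> * x + 7 / 2 \<le> \<delta> / 2 * x\<^sup>2"
      using assms \<kappa> by real_asymp
    then show ?thesis
    proof eventually_elim
      case (elim x)
      have "5 / 2 * (\<kappa> * x + 1)\<^sup>2 = 5 / 2 * \<kappa>\<^sup>2 * x\<^sup>2 + 5 * \<kappa> * x + 5 / 2"
        by (simp add: power2_eq_square algebra_simps)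
      also have "5 / 2 * \<kappa>\<^sup>2 * x\<^sup>2 = 1 / 5 * (C * x\<^sup>2)"
        unfolding \<kappa>(2) by simp
      finally have "5 / 2 * (\<kappa> * x + 1)\<^sup>2 = 1 / 5 * (C * x\<^sup>2) + 5 * \<kappa> * x + 5 / 2" .
      moreover have "(K4_const + \<delta>) * x\<^sup>2 = C * x\<^sup>2 + \<delta> / 2 * x\<^sup>2"
        by (simp add: C_def algebra_simps)
      ultimately show ?case using elim by linarith
    qed
  qed
  moreover have "\<forall>\<^sub>F x::real in at_top. 0 < x" by (rule eventually_gt_at_top)
  ultimately have "\<forall>\<^sub>F x in at_top. 0 < x \<and> x ^ 10 * (2 + 4 / 5 * C * x\<^sup>2) * exp (- a * x) < 1
      \<and> 5 / 2 * (\<kappa> * x + 1)\<^sup>2 + (4 / 5 * C * x\<^sup>2 + 1) \<le> (K4_const + \<delta>) * x\<^sup>2"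
    by (intro eventually_conj)
  moreover have "filterlim (\<lambda>n::nat. real n powr (1/5)) at_top sequentially"
    by real_asymp
  ultimately have "\<forall>\<^sub>F n::nat in sequentially. let x = real n powr (1/5) in
      0 < x \<and> x ^ 10 * (2 + 4 / 5 * C * x\<^sup>2) * exp (- a * x) < 1
      \<and> 5 / 2 * (\<kappa> * x + 1)\<^sup>2 + (4 / 5 * C * x\<^sup>2 + 1) \<le> (K4_const + \<delta>) * x\<^sup>2"
    unfolding Let_def by (rule eventually_compose_filterlim)
  then show ?thesis
  proof eventually_elim
    case (elim n)
    \<comment> \<open>\<open>\<kappa>\<close> is chosen so that \<open>5 k\<^sup>2 / 2\<close> and \<open>p\<close> share \<open>C x\<^sup>2\<close> in the ratio 1 : 4.\<close>
    define x where "x = real n powr (1/5)"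
    define k where "k = nat \<lceil>\<kappa> * x\<rceil>"
    define p where "p = nat \<lceil>4 / 5 * C * x\<^sup>2\<rceil>"
    have x: "0 < x" "x ^ 10 * (2 + 4 / 5 * C * x\<^sup>2) * exp (- a * x) < 1"
      "5 / 2 * (\<kappa> * x + 1)\<^sup>2 + (4 / 5 * C * x\<^sup>2 + 1) \<le> (K4_const + \<delta>) * x\<^sup>2"
      using elim by (simp_all add: x_def Let_def)
    then have "0 < real n" by (simp add: x_def)
    then have n: "real n = x ^ 5" "real n powr (2/5) = x\<^sup>2"
      by (simp_all add: x_def powr_powr flip: powr_numeral)
    have "0 < \<kappa> * x" using \<kappa> x by simp
    then have k: "0 < k" "\<kappa> * x \<le> real k" "real k \<le> \<kappa> * x + 1"
      unfolding k_def by linarith+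
    have "0 < 4 / 5 * C * x\<^sup>2" using C x by simp
    then have p: "4 / 5 * C * x\<^sup>2 \<le> real p" "real p \<le> 4 / 5 * C * x\<^sup>2 + 1"
      unfolding p_def by linarith+
    \<comment> \<open>Rounding \<open>k\<close> and \<open>p\<close> up only lowers the quotient; as
      \<open>r < 1\<close>, rounding \<open>k\<close> up also lowers \<open>r ^ k\<close>
      below.\<close>
    have "exp 1 * real n / (real k * (1 + real p)\<^sup>2) \<le> exp 1 * real n / (\<kappa> * x * (4 / 5 * C * x\<^sup>2)\<^sup>2)"
      using k p C \<kappa> x by (intro divide_left_mono mult_mono power_mono mult_pos_pos) auto
    also have "\<dots> = r"
      using x C \<kappa> unfolding n r_def by (simp add: field_simps eval_nat_numeral)
    finally have "exp 1 * real n / (real k * (1 + real p)\<^sup>2) \<le> r" .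
    moreover have "(real n)\<^sup>2 * (1 + real p) * r ^ k < 1"
    proof -
      have "r ^ k = r powr real k" using r by (simp add: powr_realpow)
      also have "\<dots> \<le> r powr (\<kappa> * x)" using k r by (intro powr_mono') auto
      also have "\<dots> = exp (- a * x)" using r by (simp add: powr_def a_def mult_ac)
      finally have "r ^ k \<le> exp (- a * x)" .
      then have "(real n)\<^sup>2 * (1 + real p) * r ^ k \<le> x ^ 10 * (2 + 4 / 5 * C * x\<^sup>2) * exp (- a * x)"
        using p r C x unfolding n by (intro mult_mono) (auto simp flip: power_mult)
      then show ?thesis using x by linarith
    qed
    ultimately have "real (threshold_bias_K4 n) \<le> 5 / 2 * (real k)\<^sup>2 + real p"
      by (rule threshold_bias_le[OF k(1)])
    also have "\<dots> \<le> 5 / 2 * (\<kappa> * x + 1)\<^sup>2 + (4 / 5 * C * x\<^sup>2 + 1)"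
      using k p by (intro add_mono mult_left_mono power_mono) auto
    finally show ?case using x n by simp
  qed
qed

theorem theorem1p9:
  "\<exists>\<epsilon> :: nat \<Rightarrow> real. \<epsilon> \<longlonglongrightarrow> 0 \<and>
     (\<forall>\<^sub>F n in sequentially.
        real (threshold_bias_K4 n)
          \<le> (5 powr (6/5) * 2 powr (-9/5) * exp 1 powr (2/5) + \<epsilon> n) * real n powr (2/5))"
proof -
  \<comment> \<open>Truncation at 0 gives convergence even if the quotient stays below
    \<open>K4_const\<close>.\<close>
  define \<epsilon> where "\<epsilon> n = max 0 (real (threshold_bias_K4 n) / real n powr (2/5) - K4_const)" for n
  have "\<forall>\<^sub>F n in sequentially. \<epsilon> n < \<delta>" if "0 < \<delta>" for \<delta>
  proof -
    have "0 < \<delta> / 2" using that by simp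
    from eventually_threshold_bias_le[OF this] eventually_gt_at_top[of 0] show ?thesis
    proof eventually_elim
      case (elim n)
      then have "real (threshold_bias_K4 n) / real n powr (2/5) \<le> K4_const + \<delta> / 2"
        by (simp add: divide_le_eq)
      then show ?case using that by (simp add: \<epsilon>_def)
    qed
  qed
  moreover have "0 \<le> \<epsilon> n" for n by (simp add: \<epsilon>_def)
  ultimately have "\<epsilon> \<longlonglongrightarrow> 0"
    by (intro order_tendstoI) (auto intro!: always_eventually intro: less_le_trans)
  moreover have "\<forall>\<^sub>F n in sequentially.
      real (threshold_bias_K4 n) \<le> (K4_const + \<epsilon> n) * real n powr (2/5)"
    using eventually_gt_at_top[of 0]
  proof eventually_elim
    case (elim n)
    have "real (threshold_bias_K4 n) / real n powr (2/5) \<le> K4_const + \<epsilon> n"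
      by (simp add: \<epsilon>_def)
    then show ?case using elim by (simp add: divide_le_eq)
  qed
  ultimately show ?thesis unfolding K4_const_def by blast
qed

end
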